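(* Let $r\ge2$ and $d=2r$, let $\mathbb{T}_d$ be the Cayley graph of the free group $\mathbf{F}_r$ of rank $r$ with respect to some basis, and let $S\subseteq \mathbf{F}_r=V(\mathbb{T}_d)$ be the subset of proper powers. Then $\beta(S)=2\sqrt{d-1}$.
   Context: A proper power in $\mathbf{F}_r$ is an element of the form $u^m$ with $u\in\mathbf{F}_r$ and $m\ge2$. The Cayley graph of $\mathbf{F}_r$ with respect to a basis is the $d$-regular tree with $d=2r$; its root $o$ is the identity element. For $S\subseteq V(\mathbb{T}_d)$, $b_t(S)$ is the number of arbitrary (not necessarily non-backtracking) walks of length $t$ in $\mathbb{T}_d$ that begin at $o$ and end in $S$, and $\beta(S)=\limsup_{t\to\infty}b_t(S)^{1/t}$. *)

theory Defs
  imports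
    "HOL-Algebra.Group"
    "HOL-Library.Liminf_Limsup"
    "HOL-Library.Extended_Real"
    "Graph_Theory.Graph_Theory"
begin

text \<open>
  Words over \<open>B\<close> and its formal inverses: the letter \<open>(b, True)\<close> stands for \<open>b\<close> and
  \<open>(b, False)\<close> for the inverse of \<open>b\<close>.
\<close>

definition letter_val :: "('a, 'b) monoid_scheme \<Rightarrow> 'a \<times> bool \<Rightarrow> 'a" where
  "letter_val G l = (if snd l then fst l else inv\<^bsub>G\<^esub> (fst l))"

definition word_val :: "('a, 'b) monoid_scheme \<Rightarrow> ('a \<times> bool) list \<Rightarrow> 'a" where
  "word_val G w = foldr (\<lambda>l x. letter_val G l \<otimes>\<^bsub>G\<^esub> x) w \<one>\<^bsub>G\<^esub>"

definition reduced_words :: "'a set \<Rightarrow> ('a \<times> bool) list set" where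
  "reduced_words B =
     {w \<in> lists (B \<times> UNIV). successively (\<lambda>k l. \<not> (fst k = fst l \<and> snd k \<noteq> snd l)) w}"

text \<open>
  The group \<open>G\<close> is free on \<open>B\<close>: every element is the value of exactly one reduced word over \<open>B\<close>.
  Being free of rank \<open>r\<close> means having such a basis with \<open>r\<close> elements. (The universal property
  is not used as the definition because it quantifies over groups of all types.)
\<close>

definition free_basis :: "('a, 'b) monoid_scheme \<Rightarrow> 'a set \<Rightarrow> bool" where
  "free_basis G B \<longleftrightarrow>
     B \<subseteq> carrier G \<and> bij_betw (word_val G) (reduced_words B) (carrier G)"

text \<open>
  The undirected Cayley graph, as a symmetric digraph whose arcs are pairs of vertices. When \<open>B\<close>
  is a free basis the elements of \<open>B\<close> and their inverses are pairwise distinct, so no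
  multiplicities are lost, and the graph is regular of degree \<open>2 * card B\<close>.
\<close>

definition cayley_graph :: "('a, 'b) monoid_scheme \<Rightarrow> 'a set \<Rightarrow> 'a pair_pre_digraph" where
  "cayley_graph G B =
     \<lparr> pverts = carrier G,
       parcs = {(g, h). g \<in> carrier G \<and>
                  (\<exists>b\<in>B. h = g \<otimes>\<^bsub>G\<^esub> b \<or> h = g \<otimes>\<^bsub>G\<^esub> inv\<^bsub>G\<^esub> b)} \<rparr>"

definition walk_count :: "'a pair_pre_digraph \<Rightarrow> 'a \<Rightarrow> 'a set \<Rightarrow> nat \<Rightarrow> nat" where
  "walk_count T v S t =
     card {p. length p = t \<and> (\<exists>w\<in>S. pre_digraph.awalk (with_proj T) v p w)}"

definition walk_growth :: "'a pair_pre_digraph \<Rightarrow> 'a \<Rightarrow> 'a set \<Rightarrow> ereal" where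
  "walk_growth T v S = limsup (\<lambda>t. ereal (root t (real (walk_count T v S t))))"

text \<open>The identity is a proper power, being its own square.\<close>

definition proper_powers :: "('a, 'b) monoid_scheme \<Rightarrow> 'a set" where
  "proper_powers G = {u [^]\<^bsub>G\<^esub> m | (u :: 'a) (m :: nat). u \<in> carrier G \<and> 2 \<le> m}"

end

theory Submission
  imports Defs "HOL-Real_Asymp.Real_Asymp"
begin

text \<open>
  Put \<open>q = d - 1\<close>. The identity is a proper power, and the walks from the root back to itself
  already grow like \<open>(2 \<surd>q)\<^sup>t\<close>. Conversely, since a positive eigenfunction with eigenvalue
  \<open>2 \<surd>q\<close> decays like \<open>k / (\<surd>q)\<^sup>k\<close> with the distance \<open>k\<close> to the root, at most
  \<open>(1 + k) (2 \<surd>q)\<^sup>t / (\<surd>q)\<^sup>k\<close> walks of length \<open>t\<close> end at a given vertex at distance \<open>k\<close>.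
  A proper power at distance \<open>k\<close> is \<open>g h\<^sup>m g\<inverse>\<close> without cancellation, with \<open>m \<ge> 2\<close>, so up to a
  polynomial factor there are only \<open>(\<surd>q)\<^sup>k\<close> of them, and both exponential factors cancel.
\<close>

section \<open>Letters and reduced words\<close>

definition inv_letter :: "'a \<times> bool \<Rightarrow> 'a \<times> bool" where
  "inv_letter l = (fst l, \<not> snd l)"

lemma inv_letter_inv_letter [simp]: "inv_letter (inv_letter l) = l"
  by (simp add: inv_letter_def)

lemma inv_letter_neq [simp]: "inv_letter l \<noteq> l" "l \<noteq> inv_letter l"
  by (auto simp: inv_letter_def prod_eq_iff)

lemma inv_letter_mem [simp]: "inv_letter l \<in> B \<times> UNIV \<longleftrightarrow> l \<in> B \<times> UNIV"
  by (cases l) (simp add: inv_letter_def)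

lemma card_letters: "card (B \<times> (UNIV :: bool set)) = 2 * card B"
  by (simp add: card_cartesian_product)

lemma reduced_words_iff:
  "w \<in> reduced_words B \<longleftrightarrow> w \<in> lists (B \<times> UNIV) \<and> successively (\<lambda>k l. l \<noteq> inv_letter k) w"
proof -
  have "(\<lambda>k l. \<not> (fst k = fst l \<and> snd k \<noteq> snd l)) = (\<lambda>(k :: 'a \<times> bool) l. l \<noteq> inv_letter k)"
    by (auto simp: fun_eq_iff inv_letter_def prod_eq_iff)
  then show ?thesis
    unfolding reduced_words_def by (simp only: mem_Collect_eq)
qed

lemma reduced_words_Nil [simp]: "[] \<in> reduced_words B"
  by (simp add: reduced_words_iff)

lemma reduced_words_Cons:
  "l # w \<in> reduced_words B \<longleftrightarrow>
     l \<in> B \<times> UNIV \<and> w \<in> reduced_words B \<and> (w \<noteq> [] \<longrightarrow> hd w \<noteq> inv_letter l)"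
  by (auto simp: reduced_words_iff successively_Cons)

lemma reduced_words_append:
  "v @ w \<in> reduced_words B \<longleftrightarrow> v \<in> reduced_words B \<and> w \<in> reduced_words B \<and>
     (v \<noteq> [] \<longrightarrow> w \<noteq> [] \<longrightarrow> hd w \<noteq> inv_letter (last v))"
  by (auto simp: reduced_words_iff successively_append_iff)

text \<open>Left multiplication by a letter, carried out on reduced words. At most one cancellation
  can occur, at the front, so one case distinction suffices.\<close>

definition prepend :: "'a \<times> bool \<Rightarrow> ('a \<times> bool) list \<Rightarrow> ('a \<times> bool) list" where
  "prepend l w = (if w \<noteq> [] \<and> hd w = inv_letter l then tl w else l # w)"

lemma prepend_Nil [simp]: "prepend l [] = [l]"
  by (simp add: prepend_def)

lemma prepend_Cons: "prepend l (a # w) = (if l = inv_letter a then w else l # a # w)"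
  by (auto simp: prepend_def)

lemma prepend_reduced:
  "l \<in> B \<times> UNIV \<Longrightarrow> w \<in> reduced_words B \<Longrightarrow> prepend l w \<in> reduced_words B"
  by (cases w) (auto simp: prepend_Cons reduced_words_Cons)

section \<open>Walk counts to a single vertex and their upper bound\<close>

text \<open>The number of walks of length \<open>t\<close> from the identity to the vertex \<open>w\<close>: if the first step is the
  letter \<open>l\<close>, translating by its inverse leaves a walk of length \<open>t - 1\<close> to \<open>l\<inverse> w\<close>, and the letters
  are closed under inversion.\<close>

fun return_count :: "'a set \<Rightarrow> nat \<Rightarrow> ('a \<times> bool) list \<Rightarrow> nat" where
  "return_count B 0 w = (if w = [] then 1 else 0)"
| "return_count B (Suc t) w = (\<Sum>l\<in>B \<times> UNIV. return_count B t (prepend l w))"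

text \<open>Only \<open>inv_letter a\<close> cancels against the first letter; every other letter
  lengthens the word. This is the tree structure: one neighbour nearer to the root, all others
  farther away.\<close>

lemma return_count_Cons:
  assumes "finite B" "a \<in> B \<times> UNIV"
  shows "return_count B (Suc t) (a # w) =
    return_count B t w + (\<Sum>l\<in>B \<times> UNIV - {inv_letter a}. return_count B t (l # a # w))"
proof -
  have "return_count B (Suc t) (a # w) = return_count B t (prepend (inv_letter a) (a # w)) +
      (\<Sum>l\<in>B \<times> UNIV - {inv_letter a}. return_count B t (prepend l (a # w)))"
    unfolding return_count.simps using assms by (intro sum.remove) auto
  also have "(\<Sum>l\<in>B \<times> UNIV - {inv_letter a}. return_count B t (prepend l (a # w))) =
      (\<Sum>l\<in>B \<times> UNIV - {inv_letter a}. return_count B t (l # a # w))"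
    by (intro sum.cong) (auto simp: prepend_Cons)
  finally show ?thesis
    by (simp add: prepend_Cons)
qed

lemma card_letters_remove:
  "finite B \<Longrightarrow> a \<in> B \<times> UNIV \<Longrightarrow> card (B \<times> UNIV - {inv_letter a}) = 2 * card B - 1"
  by (simp add: card_letters)

text \<open>One step shortens the remaining word by at most one letter.\<close>

lemma return_count_eq_0: "t < length w \<Longrightarrow> return_count B t w = 0"
proof (induction t arbitrary: w)
  case (Suc t)
  have "t < length (prepend l w)" for l
    using Suc.prems by (cases w) (auto simp: prepend_Cons)
  then show ?case
    using Suc.IH by simp
qed auto

text \<open>The weight \<open>(1 + c k) / (\<surd>q)\<^sup>k\<close> with \<open>c = (q - 1) / (q + 1)\<close>, as a function of the distance
  \<open>k\<close> to the root, is an eigenfunction of the adjacency operator with eigenvalue \<open>2 \<surd>q\<close>.\<close>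

lemma return_count_le:
  fixes B :: "'a set"
  defines "q \<equiv> 2 * real (card B) - 1"
  assumes B: "finite B" "B \<noteq> {}" and w: "w \<in> lists (B \<times> UNIV)"
  shows "real (return_count B t w) * sqrt q ^ length w
           \<le> (2 * sqrt q) ^ t * (1 + (q - 1) / (q + 1) * real (length w))"
  using w
proof (induction t arbitrary: w)
  case 0
  have "q \<ge> 1"
    using B unfolding q_def by (simp add: Suc_le_eq card_gt_0_iff)
  then show ?case by auto
next
  case (Suc t)
  define c where "c = (q - 1) / (q + 1)"
  have q: "q \<ge> 1"
    using B unfolding q_def by (simp add: Suc_le_eq card_gt_0_iff)
  have s: "sqrt q > 0" "sqrt q * sqrt q = q"
    using q by auto
  show ?case
  proof (cases w)
    case Nil
    have 1: "real (return_count B t [l]) * sqrt q \<le> (2 * sqrt q) ^ t * (1 + c)"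
      if "l \<in> B \<times> UNIV" for l
      using Suc.IH[of "[l]"] that by (simp add: c_def)
    have "real (return_count B (Suc t) []) * sqrt q =
        (\<Sum>l\<in>B \<times> UNIV. real (return_count B t [l]) * sqrt q)"
      by (simp add: sum_distrib_right)
    also have "\<dots> \<le> real (card (B \<times> (UNIV :: bool set))) * ((2 * sqrt q) ^ t * (1 + c))"
      using 1 by (intro sum_bounded_above) auto
    also have "real (card (B \<times> (UNIV :: bool set))) = q + 1"
      by (simp add: card_letters q_def)
    also have "(q + 1) * ((2 * sqrt q) ^ t * (1 + c)) = (2 * sqrt q) ^ t * ((q + 1) * (1 + c))"
      by simp
    \<comment> \<open>This equation at the root determines \<open>c\<close>; away from the root any
      affine function of the distance would do.\<close>
    also have "(q + 1) * (1 + c) = 2 * q"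
      using q by (simp add: c_def field_simps)
    also have "(2 * sqrt q) ^ t * (2 * q) = (2 * sqrt q) ^ Suc t * sqrt q"
      using s by (simp add: algebra_simps)
    finally show ?thesis
      using s by (simp add: Nil mult_ac del: return_count.simps)
  next
    case (Cons a v)
    define k where "k = length v"
    have a: "a \<in> B \<times> UNIV" and v: "v \<in> lists (B \<times> UNIV)"
      using Suc.prems Cons by auto
    have down: "real (return_count B t v) * sqrt q ^ k \<le> (2 * sqrt q) ^ t * (1 + c * k)"
      using Suc.IH[OF v] by (simp add: c_def k_def)
    have up: "real (return_count B t (l # a # v)) * sqrt q ^ (k + 2)
        \<le> (2 * sqrt q) ^ t * (1 + c * (real k + 2))" if "l \<in> B \<times> UNIV - {inv_letter a}" for l
      using Suc.IH[of "l # a # v"] that a v by (simp add: c_def k_def algebra_simps)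
    have "(\<Sum>l\<in>B \<times> UNIV - {inv_letter a}. real (return_count B t (l # a # v)) * sqrt q ^ (k + 2))
        \<le> real (card (B \<times> UNIV - {inv_letter a})) * ((2 * sqrt q) ^ t * (1 + c * (real k + 2)))"
      using up by (intro sum_bounded_above)
    also have "real (card (B \<times> UNIV - {inv_letter a})) = q"
      using B a q by (simp add: card_letters_remove q_def Suc_le_eq card_gt_0_iff)
    finally have "sqrt q ^ (k + 2) * (\<Sum>l\<in>B \<times> UNIV - {inv_letter a}. real (return_count B t (l # a # v)))
        \<le> q * ((2 * sqrt q) ^ t * (1 + c * (real k + 2)))"
      by (simp only: sum_distrib_left mult.commute)
    \<comment> \<open>The two extra factors \<open>sqrt q\<close> carried by the longer words cancel
      the number \<open>q\<close> of these words.\<close>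
    moreover have "sqrt q ^ (k + 2) = q * sqrt q ^ k"
      using s by (simp add: power_add power2_eq_square)
    ultimately have "q * (sqrt q ^ k * (\<Sum>l\<in>B \<times> UNIV - {inv_letter a}. real (return_count B t (l # a # v))))
        \<le> q * ((2 * sqrt q) ^ t * (1 + c * (real k + 2)))"
      by (simp only: mult.assoc)
    then have ups: "sqrt q ^ k * (\<Sum>l\<in>B \<times> UNIV - {inv_letter a}. real (return_count B t (l # a # v)))
        \<le> (2 * sqrt q) ^ t * (1 + c * (real k + 2))"
      using q by (subst (asm) mult_le_cancel_left_pos) auto
    have "real (return_count B (Suc t) (a # v)) * sqrt q ^ k
       \<le> (2 * sqrt q) ^ t * (1 + c * k) + (2 * sqrt q) ^ t * (1 + c * (real k + 2))"
      unfolding return_count_Cons[OF B(1) a] using down ups by (simp add: algebra_simps)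
    \<comment> \<open>An affine function takes at \<open>k + 1\<close> the mean of its values at
      \<open>k\<close> and \<open>k + 2\<close>.\<close>
    also have "\<dots> = (2 * sqrt q) ^ t * (2 * (1 + c * (real k + 1)))"
      by (simp add: algebra_simps)
    finally have "real (return_count B (Suc t) (a # v)) * sqrt q ^ k * sqrt q
       \<le> (2 * sqrt q) ^ t * (2 * (1 + c * (real k + 1))) * sqrt q"
      using s by (intro mult_right_mono) auto
    then show ?thesis
      by (simp add: Cons k_def c_def algebra_simps del: return_count.simps)
  qed
qed

section \<open>Ballot numbers and the lower bound for a single vertex\<close>

text \<open>The ballot number \<open>(k + 1) / (2 * j + k + 1)\<close> times the binomial
  coefficient of \<open>2 * j + k + 1\<close> over \<open>j\<close>, written with factorials so that
  the recursions become identities of fractions.\<close>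

definition ballot :: "nat \<Rightarrow> nat \<Rightarrow> real" where
  "ballot j k = (real k + 1) * fact (2 * j + k) / (fact j * fact (j + k + 1))"

lemma ballot_0 [simp]: "ballot 0 k = 1"
  by (simp add: ballot_def)

lemma ballot_nonneg: "ballot j k \<ge> 0"
  by (simp add: ballot_def)

text \<open>A nonnegative path at height 0 has to start with an up-step.\<close>

lemma ballot_Suc_0: "ballot (Suc j) 0 = ballot j 1"
proof -
  have "ballot (Suc j) 0 =
      (2 * (real j + 1) * fact (2 * j + 1)) / ((real j + 1) * (fact j * fact (j + 2)))"
    by (simp add: ballot_def algebra_simps)
  also have "\<dots> = ballot j 1"
    by (simp add: ballot_def divide_simps del: fact_Suc)
  finally show ?thesis .
qed

text \<open>First-step decomposition: a path from height \<open>k + 1\<close> goes down and keeps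
  its up-steps, or goes up and spends one.\<close>

lemma ballot_Suc_Suc: "ballot (Suc j) (Suc k) = ballot (Suc j) k + ballot j (k + 2)"
proof -
  \<comment> \<open>With the common factorials named, all three terms are rational multiples of
    \<open>F / (A * D)\<close>.\<close>
  define F where "F = (fact (2 * j + k + 2) :: real)"
  define A where "A = (fact j :: real)"
  define D where "D = (fact (j + k + 2) :: real)"
  have pos: "F > 0" "A > 0" "D > 0"
    by (auto simp: F_def A_def D_def)
  have 1: "ballot (Suc j) (Suc k) =
      (real k + 2) * ((2 * real j + k + 3) * F) / (((real j + 1) * A) * ((real j + k + 3) * D))"
    by (simp add: ballot_def F_def A_def D_def algebra_simps)
  have 2: "ballot (Suc j) k = (real k + 1) * F / (((real j + 1) * A) * D)"
    by (simp add: ballot_def F_def A_def D_def algebra_simps)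
  have 3: "ballot j (k + 2) = (real k + 3) * F / (A * ((real j + k + 3) * D))"
    by (simp add: ballot_def F_def A_def D_def algebra_simps)
  have nz: "real j + 1 \<noteq> 0" "real j + real k + 3 \<noteq> 0"
    by linarith+
  show ?thesis
    unfolding 1 2 3 using pos nz by (simp add: divide_simps) (simp add: algebra_simps)
qed

text \<open>At height 0 these are the Catalan numbers.\<close>

lemma ballot_0_right: "ballot n 0 = real ((2 * n) choose n) / (real n + 1)"
  by (simp add: ballot_def binomial_fact divide_simps)

text \<open>\<open>ballot j k\<close> counts the nonnegative lattice paths from height \<open>k\<close> to \<open>0\<close> with \<open>j\<close> up-steps,
  and each up-step can be realised by at least \<open>q\<close> letters.\<close>

lemma return_count_ge:
  fixes B :: "'a set"
  defines "q \<equiv> 2 * real (card B) - 1"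
  assumes B: "finite B" "B \<noteq> {}" and w: "w \<in> lists (B \<times> UNIV)"
  shows "q ^ j * ballot j (length w) \<le> real (return_count B (2 * j + length w) w)"
  using w
\<comment> \<open>The induction is on the length of the walk, since a down-step leaves
  \<open>j\<close> unchanged and an up-step lengthens \<open>w\<close>.\<close>
proof (induction "2 * j + length w" arbitrary: j w)
  case 0
  then show ?case by simp
next
  case (Suc t)
  have q: "q \<ge> 1"
    using B unfolding q_def by (simp add: Suc_le_eq card_gt_0_iff)
  show ?case
  proof (cases w)
    case Nil
    with Suc.hyps(2) obtain i where j: "j = Suc i" and t: "t = 2 * i + 1"
      by (cases j) auto
    have 1: "q ^ i * ballot i 1 \<le> real (return_count B t [l])" if "l \<in> B \<times> UNIV" for l
      using Suc.hyps(1)[of i "[l]"] that t by simp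
    \<comment> \<open>All \<open>q + 1\<close> letters lengthen the empty word; the bound claims
      only \<open>q\<close> of them.\<close>
    have "q ^ j * ballot j 0 \<le> (q + 1) * (q ^ i * ballot i 1)"
      using q ballot_nonneg[of i 1] by (simp add: j ballot_Suc_0 algebra_simps)
    also have "q + 1 = real (card (B \<times> (UNIV :: bool set)))"
      by (simp add: card_letters q_def)
    also have "\<dots> * (q ^ i * ballot i 1) \<le> (\<Sum>l\<in>B \<times> UNIV. real (return_count B t [l]))"
      using 1 by (intro sum_bounded_below)
    also have "\<dots> = real (return_count B (Suc t) [])"
      by simp
    finally show ?thesis
      using Suc.hyps(2) Nil by simp
  next
    case (Cons a v)
    define k where "k = length v"
    have a: "a \<in> B \<times> UNIV" and v: "v \<in> lists (B \<times> UNIV)"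
      using Suc.prems Cons by auto
    have down: "q ^ j * ballot j k \<le> real (return_count B t v)"
      using Suc.hyps(1)[of j v] v Suc.hyps(2) by (simp add: Cons k_def)
    show ?thesis
    proof (cases j)
      \<comment> \<open>Without up-steps only the direct descent is counted; the other summands are
        nonnegative and dropped.\<close>
      case 0
      then show ?thesis
        using Suc.hyps(2) down return_count_Cons[OF B(1) a, of t v]
        by (simp add: Cons sum_nonneg add_increasing2 del: return_count.simps)
    next
      case (Suc i)
      have up: "q ^ i * ballot i (k + 2) \<le> real (return_count B t (l # a # v))"
        if "l \<in> B \<times> UNIV - {inv_letter a}" for l
        using Suc.hyps(1)[of i "l # a # v"] Suc.hyps(2) that a v
        by (simp add: Suc Cons k_def)
      have "q * (q ^ i * ballot i (k + 2)) =
          real (card (B \<times> UNIV - {inv_letter a})) * (q ^ i * ballot i (k + 2))"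
        using B a q by (simp add: card_letters_remove q_def Suc_le_eq card_gt_0_iff)
      also have "\<dots> \<le> (\<Sum>l\<in>B \<times> UNIV - {inv_letter a}. real (return_count B t (l # a # v)))"
        using up by (intro sum_bounded_below)
      finally have "q ^ j * ballot j k + q * (q ^ i * ballot i (k + 2))
          \<le> real (return_count B (Suc t) (a # v))"
        unfolding return_count_Cons[OF B(1) a] using down by simp
      then show ?thesis
        using Suc.hyps(2)
        by (simp add: Cons Suc ballot_Suc_Suc k_def algebra_simps del: return_count.simps)
    qed
  qed
qed

section \<open>Counting reduced words\<close>

text \<open>After \<open>a\<close> any letter but \<open>inv_letter a\<close> may follow, which
  gives one factor \<open>2 * card B - 1\<close> per further letter. Finiteness is carried along
  because an infinite set has \<open>card\<close> 0.\<close>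

lemma card_reduced_words_hd:
  assumes "finite B" "a \<in> B \<times> UNIV"
  shows "finite {w \<in> reduced_words B. length w = Suc n \<and> hd w = a} \<and>
    card {w \<in> reduced_words B. length w = Suc n \<and> hd w = a} \<le> (2 * card B - 1) ^ n"
  using assms(2)
proof (induction n arbitrary: a)
  case 0
  have sub: "{w \<in> reduced_words B. length w = Suc 0 \<and> hd w = a} \<subseteq> {[a]}"
    by (auto simp: length_Suc_conv)
  show ?case
    using card_mono[OF _ sub] finite_subset[OF sub] by simp
next
  case (Suc n)
  let ?H = "\<lambda>n a. {w \<in> reduced_words B. length w = Suc n \<and> hd w = a}"
  have sub: "?H (Suc n) a \<subseteq> (\<Union>b\<in>B \<times> UNIV - {inv_letter a}. (#) a ` ?H n b)"
  proof
    fix w assume "w \<in> ?H (Suc n) a"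
    then obtain b v where w: "w = a # b # v" "length v = n" "a # b # v \<in> reduced_words B"
      by (auto simp: length_Suc_conv)
    then have "b \<in> B \<times> UNIV - {inv_letter a}" "b # v \<in> ?H n b"
      by (auto simp: reduced_words_Cons)
    with w(1) show "w \<in> (\<Union>b\<in>B \<times> UNIV - {inv_letter a}. (#) a ` ?H n b)"
      by blast
  qed
  have fin: "finite (\<Union>b\<in>B \<times> UNIV - {inv_letter a}. (#) a ` ?H n b)"
    using Suc.IH assms(1) by auto
  have "card (?H (Suc n) a) \<le> card (\<Union>b\<in>B \<times> UNIV - {inv_letter a}. (#) a ` ?H n b)"
    using sub fin by (rule card_mono[rotated])
  also have "\<dots> \<le> (\<Sum>b\<in>B \<times> UNIV - {inv_letter a}. card ((#) a ` ?H n b))"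
    using assms(1) by (intro card_UN_le) auto
  also have "\<dots> \<le> card (B \<times> UNIV - {inv_letter a}) * (2 * card B - 1) ^ n"
  proof -
    have "card ((#) a ` ?H n b) \<le> (2 * card B - 1) ^ n" if "b \<in> B \<times> UNIV - {inv_letter a}" for b
      using Suc.IH[of b] that card_image_le[of "?H n b" "(#) a"] by force
    then show ?thesis
      using sum_bounded_above[of "B \<times> UNIV - {inv_letter a}" "\<lambda>b. card ((#) a ` ?H n b)"] by simp
  qed
  also have "\<dots> = (2 * card B - 1) ^ Suc n"
    by (simp only: card_letters_remove[OF assms(1) Suc.prems] power_Suc)
  finally show ?case
    using finite_subset[OF sub fin] by blast
qed

lemma card_reduced_words:
  assumes "finite B" "B \<noteq> {}"
  shows "finite {w \<in> reduced_words B. length w = n} \<and>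
    card {w \<in> reduced_words B. length w = n} \<le> 2 * (2 * card B - 1) ^ n"
proof (cases n)
  case 0
  then have "{w \<in> reduced_words B. length w = n} = {[]}"
    by auto
  then show ?thesis using 0 by simp
next
  case (Suc m)
  let ?H = "\<lambda>a. {w \<in> reduced_words B. length w = Suc m \<and> hd w = a}"
  have eq: "{w \<in> reduced_words B. length w = n} = (\<Union>a\<in>B \<times> UNIV. ?H a)"
    unfolding Suc by (auto simp: length_Suc_conv reduced_words_Cons)
  have "card (\<Union>a\<in>B \<times> UNIV. ?H a) \<le> (\<Sum>a\<in>B \<times> UNIV. card (?H a))"
    using assms by (intro card_UN_le) auto
  also have "\<dots> \<le> card (B \<times> (UNIV :: bool set)) * (2 * card B - 1) ^ m"
    using card_reduced_words_hd[OF assms(1)] sum_bounded_above[of "B \<times> UNIV" "\<lambda>a. card (?H a)"]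
    by simp
  \<comment> \<open>The choices for the first letter are rounded up, so that the bound has the same
    form for every length, including 0.\<close>
  also have "card (B \<times> (UNIV :: bool set)) \<le> 2 * (2 * card B - 1)"
    using assms by (simp add: card_letters Suc_le_eq card_gt_0_iff)
  finally have "card (\<Union>a\<in>B \<times> UNIV. ?H a) \<le> 2 * (2 * card B - 1) ^ n"
    by (simp add: Suc mult_ac)
  moreover have "finite (\<Union>a\<in>B \<times> UNIV. ?H a)"
    using assms card_reduced_words_hd[OF assms(1)] by auto
  ultimately show ?thesis
    unfolding eq by blast
qed

section \<open>Inverses, powers and cyclic reduction of words\<close>

definition inv_word :: "('a \<times> bool) list \<Rightarrow> ('a \<times> bool) list" where
  "inv_word w = rev (map inv_letter w)"

definition power_word :: "('a \<times> bool) list \<Rightarrow> nat \<Rightarrow> ('a \<times> bool) list" where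
  "power_word w m = concat (replicate m w)"

lemma power_word_simps [simp]:
  "power_word w 0 = []" "power_word w (Suc m) = w @ power_word w m" "power_word [] m = []"
  by (auto simp: power_word_def)

lemma length_power_word [simp]: "length (power_word w m) = m * length w"
  by (induction m) auto

lemma length_inv_word [simp]: "length (inv_word w) = length w"
  by (simp add: inv_word_def)

lemma inv_word_simps [simp]: "inv_word [] = []" "inv_word (a # w) = inv_word w @ [inv_letter a]"
  by (auto simp: inv_word_def)

lemma hd_power_word: "w \<noteq> [] \<Longrightarrow> m > 0 \<Longrightarrow> hd (power_word w m) = hd w"
  by (cases m) auto

lemma last_power_word: "w \<noteq> [] \<Longrightarrow> m > 0 \<Longrightarrow> last (power_word w m) = last w"
proof (induction m)
  case (Suc m)
  then show ?case by (cases m) auto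
qed auto

lemma power_word_eq_Nil: "power_word w m = [] \<longleftrightarrow> w = [] \<or> m = 0"
  by (cases m; cases w) auto

text \<open>As long as the first and last letters are mutually inverse, both are stripped and the
  first one joins the conjugator \<open>g\<close>.\<close>

lemma cyclic_reduction:
  assumes "w \<in> reduced_words B" "w \<noteq> []"
  shows "\<exists>g h. w = g @ h @ inv_word g \<and> h \<noteq> [] \<and> hd h \<noteq> inv_letter (last h)"
  using assms
proof (induction w rule: length_induct)
  case (1 w)
  show ?case
  proof (cases "hd w = inv_letter (last w)")
    case False
    then show ?thesis
      using 1 by (intro exI[of _ "[]"] exI[of _ w]) auto
  next
    case True
    obtain a u where w: "w = a # u"
      using 1 by (cases w) auto
    \<comment> \<open>No letter is its own inverse, so the last letter is not the first one.\<close>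
    have "u \<noteq> []"
      using True w by auto
    then obtain v b where u: "u = v @ [b]"
      by (cases u rule: rev_cases) auto
    have b: "b = inv_letter a"
      using True w u by simp
    \<comment> \<open>\<open>v\<close> is nonempty because \<open>[a, inv_letter a]\<close> is not
      reduced.\<close>
    have v: "v \<noteq> []" "v \<in> reduced_words B"
      using "1.prems" unfolding w u b by (auto simp: reduced_words_Cons reduced_words_append)
    moreover have "length v < length w"
      by (simp add: w u)
    ultimately obtain g h
      where "v = g @ h @ inv_word g" "h \<noteq> []" "hd h \<noteq> inv_letter (last h)"
      using "1.IH" by blast
    then show ?thesis
      by (intro exI[of _ "a # g"] exI[of _ h]) (simp add: w u b)
  qed
qed

text \<open>At every seam \<open>last h\<close> meets \<open>hd h\<close>, and the last assumption
  excludes cancellation there.\<close>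

lemma power_word_reduced:
  assumes "h \<in> reduced_words B" "h \<noteq> []" "hd h \<noteq> inv_letter (last h)"
  shows "power_word h m \<in> reduced_words B"
proof (induction m)
  case (Suc m)
  then show ?case
    using assms hd_power_word[OF assms(2), of m]
    by (cases "m = 0") (auto simp: reduced_words_append power_word_eq_Nil)
qed simp

text \<open>A positive power begins and ends with the same letters as \<open>h\<close>, so the seams
  with \<open>g\<close> and \<open>inv_word g\<close> are those of the given reduced word.\<close>

lemma conj_power_word_reduced:
  assumes "g @ h @ inv_word g \<in> reduced_words B" "h \<noteq> []" "hd h \<noteq> inv_letter (last h)" "m > 0"
  shows "g @ power_word h m @ inv_word g \<in> reduced_words B"
  using assms power_word_reduced[of h B m]
  by (auto simp: reduced_words_append power_word_eq_Nil hd_power_word last_power_word)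


section \<open>Values of words in the group\<close>

context group
begin

lemma word_val_simps [simp]:
  "word_val G [] = \<one>" "word_val G (l # w) = letter_val G l \<otimes> word_val G w"
  by (auto simp: word_val_def)

lemma letter_val_closed:
  "B \<subseteq> carrier G \<Longrightarrow> l \<in> B \<times> UNIV \<Longrightarrow> letter_val G l \<in> carrier G"
  by (auto simp: letter_val_def)

lemma letter_val_inv_letter:
  "B \<subseteq> carrier G \<Longrightarrow> l \<in> B \<times> UNIV \<Longrightarrow> letter_val G (inv_letter l) = inv (letter_val G l)"
  by (auto simp: letter_val_def inv_letter_def)

lemma word_val_closed:
  "B \<subseteq> carrier G \<Longrightarrow> w \<in> lists (B \<times> UNIV) \<Longrightarrow> word_val G w \<in> carrier G"
  by (induction w) (auto intro: letter_val_closed)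

lemma word_val_append:
  assumes "B \<subseteq> carrier G" "v \<in> lists (B \<times> UNIV)" "w \<in> lists (B \<times> UNIV)"
  shows "word_val G (v @ w) = word_val G v \<otimes> word_val G w"
  using assms(2)
proof (induction v)
  case Nil
  then show ?case using word_val_closed[OF assms(1,3)] by simp
next
  case (Cons l v)
  then show ?case
    using word_val_closed[OF assms(1,3)] word_val_closed[OF assms(1), of v]
      letter_val_closed[OF assms(1), of l]
    by (simp add: m_assoc)
qed

lemma inv_word_lists: "w \<in> lists (B \<times> UNIV) \<Longrightarrow> inv_word w \<in> lists (B \<times> UNIV)"
  by (induction w) auto

lemma power_word_lists: "w \<in> lists (B \<times> UNIV) \<Longrightarrow> power_word w m \<in> lists (B \<times> UNIV)"
  by (induction m) auto

lemma word_val_inv_word: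
  assumes "B \<subseteq> carrier G" "w \<in> lists (B \<times> UNIV)"
  shows "word_val G (inv_word w) = inv (word_val G w)"
  using assms(2)
proof (induction w)
  case (Cons l w)
  then have "word_val G (inv_word (l # w)) = word_val G (inv_word w) \<otimes> word_val G [inv_letter l]"
    using word_val_append[OF assms(1), of "inv_word w" "[inv_letter l]"] inv_word_lists[of w B]
    by (simp del: word_val_simps)
  then show ?case
    using Cons word_val_closed[OF assms(1), of w] letter_val_closed[OF assms(1), of l]
    by (simp add: letter_val_inv_letter[OF assms(1)] inv_mult_group)
qed simp

lemma word_val_power_word:
  assumes "B \<subseteq> carrier G" "w \<in> lists (B \<times> UNIV)"
  shows "word_val G (power_word w m) = word_val G w [^] m"
proof (induction m)
  case (Suc m)
  then show ?case
    using assms word_val_append[OF assms power_word_lists[OF assms(2)]]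
      word_val_closed[OF assms] nat_pow_Suc2 by simp
qed simp

lemma word_val_prepend:
  assumes "B \<subseteq> carrier G" "l \<in> B \<times> UNIV" "w \<in> lists (B \<times> UNIV)"
  shows "word_val G (prepend l w) = letter_val G l \<otimes> word_val G w"
proof (cases w)
  case (Cons a v)
  then show ?thesis
    using assms letter_val_closed[OF assms(1), of a] word_val_closed[OF assms(1), of v]
      letter_val_inv_letter[OF assms(1), of a]
    by (auto simp: prepend_Cons m_assoc[symmetric])
qed simp

lemma conj_nat_pow:
  assumes "x \<in> carrier G" "y \<in> carrier G"
  shows "(x \<otimes> y \<otimes> inv x) [^] (m :: nat) = x \<otimes> y [^] m \<otimes> inv x"
proof (induction m)
  case (Suc m)
  have "inv x \<otimes> (x \<otimes> z) = z" if "z \<in> carrier G" for z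
    using assms that by (simp add: m_assoc[symmetric])
  then have "(x \<otimes> y [^] m \<otimes> inv x) \<otimes> (x \<otimes> y \<otimes> inv x) = x \<otimes> y [^] m \<otimes> (inv x \<otimes> x) \<otimes> y \<otimes> inv x"
    using assms by (simp add: m_assoc)
  then show ?case
    using Suc assms by (simp add: m_assoc)
qed (use assms in simp)

section \<open>Walks in the Cayley graph\<close>

lemma cayley_graph_arcs:
  "parcs (cayley_graph G B) = {(g, h). g \<in> carrier G \<and> (\<exists>l\<in>B \<times> UNIV. h = g \<otimes> letter_val G l)}"
  by (auto simp: cayley_graph_def letter_val_def)

text \<open>One-letter words are reduced, so freeness separates their values. Hence distinct letters
  give distinct arcs at a vertex.\<close>

lemma letter_val_inj:
  assumes "free_basis G B"
  shows "inj_on (letter_val G) (B \<times> UNIV)"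
proof
  fix k l assume kl: "k \<in> B \<times> UNIV" "l \<in> B \<times> UNIV" "letter_val G k = letter_val G l"
  have "inj_on (word_val G) (reduced_words B)"
    using assms by (simp add: free_basis_def bij_betw_def)
  moreover have "[k] \<in> reduced_words B" "[l] \<in> reduced_words B"
    using kl by (auto simp: reduced_words_Cons)
  ultimately have "[k] = [l]"
    using kl letter_val_closed assms by (elim inj_onD) (auto simp: free_basis_def)
  then show "k = l"
    by simp
qed

text \<open>After a first step \<open>l\<close> the walk starts at \<open>g\<close> times
  \<open>l\<close>, and the word still to be covered is the inverse of \<open>l\<close> times
  \<open>w\<close>. The start \<open>g\<close> is therefore arbitrary in the induction.\<close>

lemma card_walks:
  assumes fb: "free_basis G B" and fin: "finite B"
    and "w \<in> reduced_words B" "g \<in> carrier G"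
  shows "finite {p. length p = t \<and>
        pre_digraph.awalk (with_proj (cayley_graph G B)) g p (g \<otimes> word_val G w)} \<and>
    card {p. length p = t \<and>
        pre_digraph.awalk (with_proj (cayley_graph G B)) g p (g \<otimes> word_val G w)} =
      return_count B t w"
  using assms(3,4)
proof (induction t arbitrary: g w)
  case 0
  have B: "B \<subseteq> carrier G" and inj: "inj_on (word_val G) (reduced_words B)"
    using fb by (auto simp: free_basis_def bij_betw_def)
  have w: "word_val G w \<in> carrier G"
    using 0 word_val_closed[OF B] by (auto simp: reduced_words_iff)
  have "g = g \<otimes> word_val G w \<longleftrightarrow> word_val G w = word_val G []"
    using 0 w by (metis l_cancel_one' word_val_simps(1))
  also have "\<dots> \<longleftrightarrow> w = []"
    using inj_onD[OF inj, of w "[]"] 0 by auto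
  finally have "{p. length p = 0 \<and>
      pre_digraph.awalk (with_proj (cayley_graph G B)) g p (g \<otimes> word_val G w)} =
    (if w = [] then {[]} else {})"
    using 0 by (auto simp: pre_digraph.awalk_def pre_digraph.cas.simps cayley_graph_def)
  then show ?case by simp
next
  case (Suc t)
  let ?aw = "pre_digraph.awalk (with_proj (cayley_graph G B))"
  let ?P = "\<lambda>l. {p. length p = t \<and> ?aw (g \<otimes> letter_val G l) p (g \<otimes> word_val G w)}"
  let ?e = "\<lambda>l. (g, g \<otimes> letter_val G l)"
  have B: "B \<subseteq> carrier G"
    using fb by (auto simp: free_basis_def)
  have wl: "w \<in> lists (B \<times> UNIV)"
    using Suc.prems by (auto simp: reduced_words_iff)
  have w: "word_val G w \<in> carrier G"
    using wl word_val_closed[OF B] by auto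
  note lc = letter_val_closed[OF B]
  \<comment> \<open>Walks are sorted by their first arc, which is labelled by a letter.\<close>
  have eq: "{p. length p = Suc t \<and> ?aw g p (g \<otimes> word_val G w)} =
      (\<Union>l\<in>B \<times> UNIV. (#) (?e l) ` ?P l)" (is "?L = ?R")
  proof (intro equalityI subsetI)
    fix p assume "p \<in> ?L"
    then obtain e p' where p: "p = e # p'" "length p' = t" "?aw g (e # p') (g \<otimes> word_val G w)"
      by (auto simp: length_Suc_conv)
    then have e: "e \<in> parcs (cayley_graph G B)" "fst e = g"
      "pre_digraph.cas (with_proj (cayley_graph G B)) (snd e) p' (g \<otimes> word_val G w)"
      "set p' \<subseteq> parcs (cayley_graph G B)"
      by (auto simp: pre_digraph.awalk_def pre_digraph.cas.simps)
    then obtain l where l: "l \<in> B \<times> UNIV" "e = ?e l"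
      by (cases e) (auto simp: cayley_graph_arcs)
    have "p' \<in> ?P l"
      using p(2) e l lc[OF l(1)] Suc.prems
      by (auto simp: pre_digraph.awalk_def cayley_graph_def)
    then show "p \<in> ?R"
      using p(1) l by blast
  next
    fix p assume "p \<in> ?R"
    then obtain l p' where l: "l \<in> B \<times> UNIV" and p: "p = ?e l # p'" "p' \<in> ?P l"
      by blast
    have "?e l \<in> parcs (cayley_graph G B)"
      using l Suc.prems by (auto simp: cayley_graph_arcs)
    then show "p \<in> ?L"
      using p Suc.prems
      by (auto simp: pre_digraph.awalk_def pre_digraph.cas.simps cayley_graph_def)
  qed
  have P: "finite (?P l) \<and> card (?P l) = return_count B t (prepend (inv_letter l) w)"
    if l: "l \<in> B \<times> UNIV" for l
  proof -
    have l': "inv_letter l \<in> B \<times> UNIV"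
      using l by simp
    have "g \<otimes> letter_val G l \<otimes> word_val G (prepend (inv_letter l) w) = g \<otimes> word_val G w"
      unfolding word_val_prepend[OF B l' wl] letter_val_inv_letter[OF B l]
      using lc[OF l] w Suc.prems by (simp add: m_assoc) (simp add: m_assoc[symmetric])
    then show ?thesis
      using Suc.IH[OF prepend_reduced[OF l' Suc.prems(1)], of "g \<otimes> letter_val G l"]
        lc[OF l] Suc.prems by simp
  qed
  have e_inj: "l = l'" if "l \<in> B \<times> UNIV" "l' \<in> B \<times> UNIV" "?e l = ?e l'" for l l'
    using that letter_val_inj[OF fb] lc Suc.prems by (auto dest: inj_onD)
  have "card ?R = (\<Sum>l\<in>B \<times> UNIV. card ((#) (?e l) ` ?P l))"
  proof (rule card_UN_disjoint)
    show "finite (B \<times> (UNIV :: bool set))"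
      using fin by simp
    show "\<forall>l\<in>B \<times> UNIV. finite ((#) (?e l) ` ?P l)"
      by (intro ballI finite_imageI conjunct1[OF P])
    show "\<forall>l\<in>B \<times> UNIV. \<forall>l'\<in>B \<times> UNIV.
        l \<noteq> l' \<longrightarrow> (#) (?e l) ` ?P l \<inter> (#) (?e l') ` ?P l' = {}"
    proof (intro ballI impI)
      fix l l' :: "'a \<times> bool" assume "l \<in> B \<times> UNIV" "l' \<in> B \<times> UNIV" "l \<noteq> l'"
      then have "?e l \<noteq> ?e l'"
        using e_inj by metis
      then show "(#) (?e l) ` ?P l \<inter> (#) (?e l') ` ?P l' = {}"
        by blast
    qed
  qed
  also have "\<dots> = (\<Sum>l\<in>B \<times> UNIV. return_count B t (prepend (inv_letter l) w))"
    using P by (intro sum.cong) (auto simp: card_image)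
  \<comment> \<open>Inversion permutes the letters, which turns the sum into the recursion of
    \<open>return_count\<close>.\<close>
  also have "\<dots> = (\<Sum>l\<in>B \<times> UNIV. return_count B t (prepend l w))"
    by (rule sum.reindex_bij_witness[of _ inv_letter inv_letter]) simp_all
  finally have "card ?R = return_count B (Suc t) w"
    by simp
  moreover have "finite ?R"
  proof (intro finite_UN_I finite_imageI)
    show "finite (B \<times> (UNIV :: bool set))"
      using fin by simp
    show "finite (?P l)" if "l \<in> B \<times> UNIV" for l
      using P[OF that] by (rule conjunct1)
  qed
  ultimately show ?case
    unfolding eq by (intro conjI)
qed

section \<open>Proper powers as words\<close>

text \<open>Cyclic reduction of a root \<open>u\<close> gives \<open>g\<close> and \<open>h\<close>;
  the word for its power is again reduced, so by uniqueness it is \<open>w\<close>. For nonempty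
  \<open>h\<close> the exponent is at most the length of \<open>w\<close>.\<close>

lemma proper_power_word:
  assumes fb: "free_basis G B"
    and w: "w \<in> reduced_words B" "word_val G w \<in> proper_powers G"
  shows "\<exists>g h m. 2 \<le> m \<and> m \<le> length w + 2 \<and> g @ h \<in> reduced_words B \<and>
           w = g @ power_word h m @ inv_word g"
proof -
  have B: "B \<subseteq> carrier G" and inj: "inj_on (word_val G) (reduced_words B)"
    and img: "word_val G ` reduced_words B = carrier G"
    using fb by (auto simp: free_basis_def bij_betw_def)
  from w(2) obtain u and m :: nat where u: "u \<in> carrier G" "2 \<le> m" "word_val G w = u [^] m"
    by (auto simp: proper_powers_def)
  then obtain v where v: "v \<in> reduced_words B" "u = word_val G v"
    using img by auto
  show ?thesis
  proof (cases "v = []")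
    case True
    then have "word_val G w = word_val G []"
      using u v by simp
    then have "w = []"
      using inj_onD[OF inj, of w "[]"] w(1) by auto
    \<comment> \<open>The identity is the square of the empty word; \<open>m = 2\<close> at length 0
      is the reason for the \<open>+ 2\<close> in the bound on \<open>m\<close>.\<close>
    then show ?thesis
      by (intro exI[of _ "[]"] exI[of _ 2]) auto
  next
    case False
    then obtain g h where gh: "v = g @ h @ inv_word g" "h \<noteq> []" "hd h \<noteq> inv_letter (last h)"
      using cyclic_reduction v by blast
    have l: "g \<in> lists (B \<times> UNIV)" "h \<in> lists (B \<times> UNIV)"
      using v(1) by (auto simp: gh(1) reduced_words_iff)
    note l' = inv_word_lists[OF l(1)] power_word_lists[OF l(2)]
    note wc = word_val_closed[OF B]
    have gh_red: "g @ h \<in> reduced_words B"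
      using v(1) by (auto simp: gh(1) reduced_words_append)
    have val: "word_val G (g @ k @ inv_word g) = word_val G g \<otimes> word_val G k \<otimes> inv (word_val G g)"
      if "k \<in> lists (B \<times> UNIV)" for k
    proof -
      have "word_val G (g @ k @ inv_word g) = word_val G g \<otimes> word_val G (k @ inv_word g)"
        using that l l' by (intro word_val_append[OF B]) auto
      also have "word_val G (k @ inv_word g) = word_val G k \<otimes> inv (word_val G g)"
        using that l l' by (simp only: word_val_append[OF B] word_val_inv_word[OF B])
      finally show ?thesis
        using wc[OF that] wc[OF l(1)] by (simp add: m_assoc)
    qed
    have "word_val G (g @ power_word h m @ inv_word g) = word_val G w"
      unfolding val[OF l'(2)] u(3) v(2) unfolding gh(1) val[OF l(2)]
      using conj_nat_pow[OF wc[OF l(1)] wc[OF l(2)]] by (simp add: word_val_power_word[OF B l(2)])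
    moreover have "g @ power_word h m @ inv_word g \<in> reduced_words B"
      using conj_power_word_reduced[of g h B m] v(1) gh u(2) by auto
    ultimately have eq: "w = g @ power_word h m @ inv_word g"
      using inj w(1) by (auto dest: inj_onD)
    have "m * 1 \<le> m * length h"
      using gh(2) by (intro mult_le_mono2) (simp add: Suc_le_eq)
    then have "m \<le> length w + 2"
      unfolding eq length_append length_power_word by linarith
    then show ?thesis
      using eq gh_red u(2) by blast
  qed
qed

text \<open>A word \<open>g h\<^sup>m g\<inverse>\<close> of length \<open>k\<close> with \<open>m \<ge> 2\<close> is determined by \<open>|g|\<close>, \<open>m\<close> and the reduced word
  \<open>g h\<close>, whose length is at most \<open>k / 2\<close>.\<close>

lemma card_proper_power_words:
  assumes fb: "free_basis G B" and fin: "finite B" "B \<noteq> {}"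
  defines "T \<equiv> \<lambda>k. {w \<in> reduced_words B. length w = k \<and> word_val G w \<in> proper_powers G}"
  shows "finite (T k) \<and>
    card (T k) \<le> 2 * (k + 1)\<^sup>2 * (k + 3) * (2 * card B - 1) ^ (k div 2)"
proof -
  let ?R = "\<lambda>n. {w \<in> reduced_words B. length w = n}"
  let ?D = "(\<Union>n\<le>k div 2. ?R n) \<times> {..k} \<times> {..k + 2}"
  let ?f = "\<lambda>(p, a, m). take a p @ power_word (drop a p) m @ inv_word (take a p)"
  have q: "2 * card B - 1 \<ge> 1"
  proof -
    have "card B > 0"
      using fin by (simp add: card_gt_0_iff)
    then show ?thesis by simp
  qed
  have sub: "T k \<subseteq> ?f ` ?D"
  proof
    fix w assume w: "w \<in> T k"
    then obtain g h m where m: "2 \<le> m" "m \<le> k + 2" and gh: "g @ h \<in> reduced_words B"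
      and eq: "w = g @ power_word h m @ inv_word g"
      using proper_power_word[OF fb, of w] by (auto simp: T_def)
    have "2 * length g + m * length h = k"
      using w by (auto simp: T_def eq)
    \<comment> \<open>\<open>g\<close> is used twice, once inverted, and \<open>h\<close> at least
      twice, so \<open>g @ h\<close> takes up at most half of the length; hence the exponent
      \<open>k div 2\<close>.\<close>
    moreover have "2 * length h \<le> m * length h"
      using m(1) by (rule mult_le_mono1)
    ultimately have "2 * length (g @ h) \<le> k"
      unfolding length_append distrib_left by (metis add_left_mono)
    then have "length (g @ h) \<le> k div 2"
      by (simp only: less_eq_div_iff_mult_less_eq mult.commute)
    moreover from this have "length g \<le> k"
      by simp
    ultimately have "(g @ h, length g, m) \<in> ?D"
      using m gh by auto
    moreover have "w = ?f (g @ h, length g, m)"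
      by (simp add: eq)
    ultimately show "w \<in> ?f ` ?D"
      by blast
  qed
  have fD: "finite ?D"
    using card_reduced_words[OF fin] by auto
  have "card (\<Union>n\<le>k div 2. ?R n) \<le> (\<Sum>n\<le>k div 2. card (?R n))"
    by (intro card_UN_le) auto
  \<comment> \<open>Every sphere is bounded by the bound for the largest one; this costs only a
    polynomial factor.\<close>
  also have "\<dots> \<le> (\<Sum>n\<le>k div 2. 2 * (2 * card B - 1) ^ (k div 2))"
  proof (intro sum_mono)
    fix n assume "n \<in> {..k div 2}"
    then have "2 * (2 * card B - 1) ^ n \<le> 2 * (2 * card B - 1) ^ (k div 2)"
      using q by (intro mult_left_mono power_increasing) auto
    then show "card (?R n) \<le> 2 * (2 * card B - 1) ^ (k div 2)"
      using card_reduced_words[OF fin, of n] by linarith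
  qed
  also have "\<dots> = (k div 2 + 1) * (2 * (2 * card B - 1) ^ (k div 2))"
    by simp
  also have "\<dots> \<le> (k + 1) * (2 * (2 * card B - 1) ^ (k div 2))"
    by (intro mult_le_mono1) auto
  finally have "card (\<Union>n\<le>k div 2. ?R n) * ((k + 1) * (k + 3))
      \<le> (k + 1) * (2 * (2 * card B - 1) ^ (k div 2)) * ((k + 1) * (k + 3))"
    by (rule mult_le_mono1)
  moreover have "card ({..k} \<times> {..k + 2}) = (k + 1) * (k + 3)"
    by (simp add: card_cartesian_product algebra_simps)
  ultimately have cD: "card ?D \<le> (k + 1) * (2 * (2 * card B - 1) ^ (k div 2)) * ((k + 1) * (k + 3))"
    by (simp only: card_cartesian_product[of "\<Union>n\<le>k div 2. ?R n"])
  have "card (T k) \<le> card (?f ` ?D)"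
    using fD sub by (intro card_mono finite_imageI)
  also have "\<dots> \<le> card ?D"
    by (rule card_image_le[OF fD])
  also note cD
  also have "(k + 1) * (2 * (2 * card B - 1) ^ (k div 2)) * ((k + 1) * (k + 3))
      = 2 * (k + 1)\<^sup>2 * (k + 3) * (2 * card B - 1) ^ (k div 2)"
    by (simp only: power2_eq_square mult_ac)
  finally have "card (T k) \<le> 2 * (k + 1)\<^sup>2 * (k + 3) * (2 * card B - 1) ^ (k div 2)" .
  moreover have "finite (T k)"
    using sub by (rule finite_subset) (rule finite_imageI[OF fD])
  ultimately show ?thesis
    by (intro conjI)
qed

section \<open>Walks ending in a set of vertices\<close>

text \<open>Only the walks returning to the identity are used. The finiteness assumption makes
  \<open>card\<close> monotone here.\<close>

lemma walk_count_ge: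
  assumes fb: "free_basis G B" and fin: "finite B" "B \<noteq> {}"
    and S: "\<one> \<in> S"
  assumes finS: "finite {p. length p = 2 * n \<and>
      (\<exists>x\<in>S. pre_digraph.awalk (with_proj (cayley_graph G B)) \<one> p x)}"
  shows "(2 * real (card B) - 1) ^ n * real ((2 * n) choose n) / (real n + 1)
    \<le> real (walk_count (cayley_graph G B) \<one> S (2 * n))"
proof -
  let ?aw = "pre_digraph.awalk (with_proj (cayley_graph G B))"
  have "return_count B (2 * n) [] = card {p. length p = 2 * n \<and> ?aw \<one> p \<one>}"
    using card_walks[OF fb fin(1) reduced_words_Nil one_closed, of "2 * n"] by simp
  also have "\<dots> \<le> walk_count (cayley_graph G B) \<one> S (2 * n)"
    unfolding walk_count_def using S finS by (intro card_mono) auto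
  finally show ?thesis
    using return_count_ge[OF fin, of "[]" n] by (simp add: ballot_0_right)
qed

text \<open>A walk of length \<open>t\<close> ends at a word of length at most \<open>t\<close>, and
  there are finitely many such words, each reached by finitely many walks.\<close>

lemma walks_finite:
  fixes t :: nat
  assumes fb: "free_basis G B" and fin: "finite B" and S: "S \<subseteq> carrier G"
  defines "T \<equiv> {w \<in> reduced_words B. length w \<le> t \<and> word_val G w \<in> S}"
  shows "finite {p. length p = t \<and>
      (\<exists>x\<in>S. pre_digraph.awalk (with_proj (cayley_graph G B)) \<one> p x)}"
    and "walk_count (cayley_graph G B) \<one> S t \<le> (\<Sum>w\<in>T. return_count B t w)"
proof -
  let ?P = "\<lambda>x. {p. length p = t \<and> pre_digraph.awalk (with_proj (cayley_graph G B)) \<one> p x}"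
  let ?L = "{p. length p = t \<and>
      (\<exists>x\<in>S. pre_digraph.awalk (with_proj (cayley_graph G B)) \<one> p x)}"
  have B: "B \<subseteq> carrier G" and img: "word_val G ` reduced_words B = carrier G"
    using fb by (auto simp: free_basis_def bij_betw_def)
  have P: "finite (?P (word_val G w)) \<and> card (?P (word_val G w)) = return_count B t w"
    if "w \<in> reduced_words B" for w
    using card_walks[OF fb fin that one_closed, of t] word_val_closed[OF B, of w] that
    by (simp add: reduced_words_iff)
  have sub: "?L \<subseteq> (\<Union>w\<in>T. ?P (word_val G w))"
  proof
    fix p assume "p \<in> ?L"
    then obtain x where x: "x \<in> S" "p \<in> ?P x"
      by blast
    then obtain w where w: "w \<in> reduced_words B" "x = word_val G w"
      using S img by blast
    have "return_count B t w \<noteq> 0"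
      using P[OF w(1)] x(2) w(2) card_gt_0_iff[of "?P x"] by auto
    then have "length w \<le> t"
      using return_count_eq_0[of t w B] by (cases "t < length w") auto
    then show "p \<in> (\<Union>w\<in>T. ?P (word_val G w))"
      using x w by (auto simp: T_def)
  qed
  have "T \<subseteq> {w. set w \<subseteq> B \<times> UNIV \<and> length w \<le> t}"
    by (auto simp: T_def reduced_words_iff)
  then have T: "finite T"
    using finite_lists_length_le[of "B \<times> (UNIV :: bool set)" t] fin
    by (auto intro: finite_subset)
  have fU: "finite (\<Union>w\<in>T. ?P (word_val G w))"
    using T P by (auto simp: T_def)
  show "finite ?L"
    using sub fU by (rule finite_subset)
  have "card ?L \<le> card (\<Union>w\<in>T. ?P (word_val G w))"
    using sub fU by (rule card_mono[rotated])
  also have "\<dots> \<le> (\<Sum>w\<in>T. card (?P (word_val G w)))"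
    using T by (rule card_UN_le)
  also have "\<dots> = (\<Sum>w\<in>T. return_count B t w)"
    using P by (intro sum.cong) (auto simp: T_def)
  finally show "walk_count (cayley_graph G B) \<one> S t \<le> (\<Sum>w\<in>T. return_count B t w)"
    by (simp add: walk_count_def)
qed

lemma walk_count_proper_powers_le:
  assumes fb: "free_basis G B" and fin: "finite B" "B \<noteq> {}"
  shows "real (walk_count (cayley_graph G B) \<one> (proper_powers G) t)
    \<le> 2 * (real t + 1) ^ 4 * (real t + 3) * (2 * sqrt (2 * real (card B) - 1)) ^ t"
proof -
  define q where "q = 2 * real (card B) - 1"
  define s where "s = sqrt q"
  have card1: "card B \<ge> 1"
    using fin by (simp add: Suc_le_eq card_gt_0_iff)
  then have q: "q \<ge> 1" "real (2 * card B - 1) = q"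
    by (auto simp: q_def )
  then have s: "s \<ge> 1" "s\<^sup>2 = q"
    by (auto simp: s_def)
  let ?T = "\<lambda>k. {w \<in> reduced_words B. length w = k \<and> word_val G w \<in> proper_powers G}"
  have T: "finite (?T k)" "card (?T k) \<le> 2 * (k + 1)\<^sup>2 * (k + 3) * (2 * card B - 1) ^ (k div 2)" for k
    using card_proper_power_words[OF fb fin, of k] by auto
  have rc: "real (return_count B t w) \<le> (2 * s) ^ t * (1 + real k) / s ^ k" if "w \<in> ?T k" for w k
  proof -
    \<comment> \<open>The coefficient of the eigenfunction is below 1, and a polynomial bound is
      enough.\<close>
    have "(q - 1) / (q + 1) * real k \<le> 1 * real k"
      using q by (intro mult_right_mono) (auto simp: divide_simps)
    then have "(2 * s) ^ t * (1 + (q - 1) / (q + 1) * real k) \<le> (2 * s) ^ t * (1 + real k)"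
      using s by (intro mult_left_mono) auto
    moreover have "real (return_count B t w) * s ^ k \<le> (2 * s) ^ t * (1 + (q - 1) / (q + 1) * real k)"
      using return_count_le[OF fin, of w t] that by (auto simp: q_def s_def reduced_words_iff)
    ultimately have "real (return_count B t w) * s ^ k \<le> (2 * s) ^ t * (1 + real k)"
      by linarith
    then show ?thesis
      using s by (simp add: pos_le_divide_eq)
  qed
  \<comment> \<open>Two of the three factors \<open>real t + 1\<close> and the factor
    \<open>real t + 3\<close> come from counting proper powers, the third from the weight
    \<open>1 + real k\<close>.\<close>
  have sphere: "(\<Sum>w\<in>?T k. real (return_count B t w)) \<le> 2 * (real t + 1) ^ 3 * (real t + 3) * (2 * s) ^ t"
    if "k \<le> t" for k
  proof -
    have "real (card (?T k)) \<le> real (2 * (k + 1)\<^sup>2 * (k + 3) * (2 * card B - 1) ^ (k div 2))"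
      by (rule of_nat_mono[OF T(2)])
    also have "\<dots> = 2 * (real k + 1)\<^sup>2 * (real k + 3) * q ^ (k div 2)"
      by (simp only: of_nat_mult of_nat_power of_nat_add q(2)) simp
    also have "\<dots> \<le> 2 * (real k + 1)\<^sup>2 * (real k + 3) * s ^ k"
    proof -
      have "q ^ (k div 2) = s ^ (2 * (k div 2))"
        by (simp add: power_mult s(2))
      also have "\<dots> \<le> s ^ k"
        using s by (intro power_increasing) auto
      finally show ?thesis
        by (intro mult_left_mono) auto
    qed
    finally have c: "real (card (?T k)) \<le> 2 * (real k + 1)\<^sup>2 * (real k + 3) * s ^ k" .
    have "(\<Sum>w\<in>?T k. real (return_count B t w))
        \<le> real (card (?T k)) * ((2 * s) ^ t * (1 + real k) / s ^ k)"
      using rc by (intro sum_bounded_above)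
    also have "\<dots> \<le> (2 * (real k + 1)\<^sup>2 * (real k + 3) * s ^ k) * ((2 * s) ^ t * (1 + real k) / s ^ k)"
      using c s by (intro mult_right_mono) auto
    \<comment> \<open>Here the growth \<open>s ^ k\<close> of the proper powers cancels the decay of
      the walk counts.\<close>
    also have "\<dots> = 2 * (real k + 1) ^ 3 * (real k + 3) * (2 * s) ^ t"
      using s by (simp add: power2_eq_square power3_eq_cube)
    also have "\<dots> \<le> 2 * (real t + 1) ^ 3 * (real t + 3) * (2 * s) ^ t"
      using that s by (intro mult_right_mono mult_mono power_mono) auto
    finally show ?thesis .
  qed
  have eq: "{w \<in> reduced_words B. length w \<le> t \<and> word_val G w \<in> proper_powers G} = (\<Union>k\<le>t. ?T k)"
    by auto
  have "proper_powers G \<subseteq> carrier G"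
    by (auto simp: proper_powers_def)
  then have "walk_count (cayley_graph G B) \<one> (proper_powers G) t
      \<le> (\<Sum>w\<in>(\<Union>k\<le>t. ?T k). return_count B t w)"
    using walks_finite(2)[OF fb fin(1), of "proper_powers G" t] unfolding eq by blast
  also have "\<dots> = (\<Sum>k\<le>t. \<Sum>w\<in>?T k. return_count B t w)"
    using T(1) by (intro sum.UNION_disjoint) auto
  finally have "real (walk_count (cayley_graph G B) \<one> (proper_powers G) t)
      \<le> real (\<Sum>k\<le>t. \<Sum>w\<in>?T k. return_count B t w)"
    by (rule of_nat_mono)
  also have "\<dots> = (\<Sum>k\<le>t. \<Sum>w\<in>?T k. real (return_count B t w))"
    by simp
  also have "\<dots> \<le> (\<Sum>k\<le>t. 2 * (real t + 1) ^ 3 * (real t + 3) * (2 * s) ^ t)"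
    using sphere by (intro sum_mono) auto
  \<comment> \<open>The \<open>t + 1\<close> spheres supply the fourth factor
    \<open>real t + 1\<close>.\<close>
  also have "\<dots> = 2 * (real t + 1) ^ 4 * (real t + 3) * (2 * s) ^ t"
    by (simp add: power4_eq_xxxx power3_eq_cube algebra_simps)
  finally show ?thesis
    by (simp add: s_def q_def)
qed

end

section \<open>Growth rates and the conclusion\<close>

text \<open>A factor whose \<open>t\<close>-th root tends to 1 does not affect the exponential
  growth rate.\<close>

lemma limsup_root_le:
  fixes f p :: "nat \<Rightarrow> real"
  assumes "\<And>t. f t \<le> p t * c ^ t" "c \<ge> 0" "(\<lambda>t. root t (p t)) \<longlonglongrightarrow> 1"
  shows "limsup (\<lambda>t. ereal (root t (f t))) \<le> ereal c"
proof -
  have "(\<lambda>t. ereal (root t (p t) * c)) \<longlonglongrightarrow> ereal (1 * c)"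
    using assms(3) by (intro tendsto_intros)
  then have "limsup (\<lambda>t. ereal (root t (p t) * c)) = ereal c"
    by (simp add: lim_imp_Limsup)
  moreover have "\<forall>\<^sub>F t in sequentially. ereal (root t (f t)) \<le> ereal (root t (p t) * c)"
    \<comment> \<open>\<open>root 0\<close> is constantly 0 and undoes no power, so
      \<open>t = 0\<close> is set aside.\<close>
    using eventually_gt_at_top[of 0]
  proof eventually_elim
    case (elim t)
    have "root t (f t) \<le> root t (p t * c ^ t)"
      using elim assms(1) by simp
    also have "\<dots> = root t (p t) * c"
      using elim assms(2) by (simp add: real_root_mult real_root_power_cancel)
    finally show ?case by simp
  qed
  ultimately show ?thesis
    using Limsup_mono by metis
qed

text \<open>A limsup is at least the limsup along a subsequence. Even times are the relevant ones,
  as the tree is bipartite and closed walks have even length.\<close>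

lemma limsup_root_ge_even:
  fixes f p :: "nat \<Rightarrow> real"
  assumes "\<And>n. n > 0 \<Longrightarrow> f (2 * n) \<ge> p n * c ^ (2 * n)" "c \<ge> 0"
    "(\<lambda>n. root (2 * n) (p n)) \<longlonglongrightarrow> 1"
  shows "limsup (\<lambda>t. ereal (root t (f t))) \<ge> ereal c"
proof -
  have "(\<lambda>n. ereal (root (2 * n) (p n) * c)) \<longlonglongrightarrow> ereal (1 * c)"
    using assms(3) by (intro tendsto_intros)
  then have "limsup (\<lambda>n. ereal (root (2 * n) (p n) * c)) = ereal c"
    by (simp add: lim_imp_Limsup)
  moreover have "\<forall>\<^sub>F n in sequentially.
      ereal (root (2 * n) (p n) * c) \<le> ((\<lambda>t. ereal (root t (f t))) \<circ> (*) 2) n"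
    using eventually_gt_at_top[of 0]
  proof eventually_elim
    case (elim n)
    have "root (2 * n) (p n) * c = root (2 * n) (p n * c ^ (2 * n))"
      using elim assms(2) by (simp add: real_root_mult real_root_power_cancel)
    also have "\<dots> \<le> root (2 * n) (f (2 * n))"
      using elim assms(1) by simp
    finally show ?case by simp
  qed
  ultimately have "ereal c \<le> limsup ((\<lambda>t. ereal (root t (f t))) \<circ> (*) 2)"
    using Limsup_mono by metis
  also have "\<dots> \<le> limsup (\<lambda>t. ereal (root t (f t)))"
    by (rule limsup_subseq_mono) (simp add: strict_mono_def)
  finally show ?thesis .
qed

theorem corollary1p3:
  fixes G :: "('a, 'b) monoid_scheme" and B :: "'a set" and r d :: nat
  assumes "group G"
    and "free_basis G B"
    and "card B = r"
    and "r \<ge> 2"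
    and "d = 2 * r"
  shows "walk_growth (cayley_graph G B) \<one>\<^bsub>G\<^esub> (proper_powers G) = ereal (2 * sqrt (real d - 1))"
proof -
  interpret group G by fact
  define q where "q = 2 * real (card B) - 1"
  have q: "q \<ge> 1" and qd: "q = real d - 1"
    using assms by (auto simp: q_def)
  \<comment> \<open>Infinite sets have \<open>card\<close> 0, so the positive rank forces
    \<open>B\<close> to be finite.\<close>
  have fin: "finite B" "B \<noteq> {}"
    using assms(3,4) by (auto intro: card_ge_0_finite)
  have pp: "proper_powers G \<subseteq> carrier G" "\<one>\<^bsub>G\<^esub> \<in> proper_powers G"
    by (auto simp: proper_powers_def intro!: exI[of _ "\<one>\<^bsub>G\<^esub>"] exI[of _ 2])
  let ?b = "\<lambda>t. real (walk_count (cayley_graph G B) \<one>\<^bsub>G\<^esub> (proper_powers G) t)"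
  have "limsup (\<lambda>t. ereal (root t (?b t))) \<le> ereal (2 * sqrt q)"
  proof (rule limsup_root_le)
    show "?b t \<le> 2 * (real t + 1) ^ 4 * (real t + 3) * (2 * sqrt q) ^ t" for t
      using walk_count_proper_powers_le[OF assms(2) fin] by (simp add: q_def)
    \<comment> \<open>The root is rewritten as a real power so that the limit becomes one of
      elementary functions.\<close>
    have "(\<lambda>t. (2 * (real t + 1) ^ 4 * (real t + 3)) powr (1 / real t)) \<longlonglongrightarrow> 1"
      by real_asymp
    moreover have "\<forall>\<^sub>F t in sequentially. (2 * (real t + 1) ^ 4 * (real t + 3)) powr (1 / real t)
        = root t (2 * (real t + 1) ^ 4 * (real t + 3))"
      using eventually_gt_at_top[of 0] by eventually_elim (simp add: root_powr_inverse)
    ultimately show "(\<lambda>t. root t (2 * (real t + 1) ^ 4 * (real t + 3))) \<longlonglongrightarrow> 1"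
      by (rule Lim_transform_eventually)
  qed (use q in auto)
  moreover have "ereal (2 * sqrt q) \<le> limsup (\<lambda>t. ereal (root t (?b t)))"
  proof (rule limsup_root_ge_even)
    fix n :: nat assume n: "n > 0"
    \<comment> \<open>Here \<open>(2 * sqrt q) ^ (2 * n)\<close> is \<open>4 ^ n * q ^ n\<close>.
      The factor \<open>2 * n\<close> comes from the bound \<open>4 ^ n / (2 * n)\<close> for the
      central binomial coefficient, and \<open>n + 1\<close> from the Catalan number.\<close>
    have "1 / (2 * real n * (real n + 1)) * (2 * sqrt q) ^ (2 * n)
        = q ^ n * (4 ^ n / (2 * real n)) / (real n + 1)"
      using q by (simp add: power_mult power_mult_distrib)
    also have "\<dots> \<le> q ^ n * real ((2 * n) choose n) / (real n + 1)"
      using q central_binomial_lower_bound[OF n] by (intro divide_right_mono mult_left_mono) auto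
    also have "\<dots> \<le> ?b (2 * n)"
      using walk_count_ge[OF assms(2) fin pp(2) walks_finite(1)[OF assms(2) fin(1) pp(1)]]
      by (simp add: q_def)
    finally show "1 / (2 * real n * (real n + 1)) * (2 * sqrt q) ^ (2 * n) \<le> ?b (2 * n)" .
  next
    have "(\<lambda>n. (1 / (2 * real n * (real n + 1))) powr (1 / (2 * real n))) \<longlonglongrightarrow> 1"
      by real_asymp
    moreover have "\<forall>\<^sub>F n in sequentially. (1 / (2 * real n * (real n + 1))) powr (1 / (2 * real n))
        = root (2 * n) (1 / (2 * real n * (real n + 1)))"
      using eventually_gt_at_top[of 0] by eventually_elim (simp add: root_powr_inverse)
    ultimately show "(\<lambda>n. root (2 * n) (1 / (2 * real n * (real n + 1)))) \<longlonglongrightarrow> 1"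
      by (rule Lim_transform_eventually)
  qed (use q in auto)
  ultimately show ?thesis
    unfolding walk_growth_def qd[symmetric] by (rule antisym)
qed

end
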